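(* Let $\mathcal{V}$ be the vertex set of a finite rooted tree with root $v_0$, of depth $L \ge 1$, which is complete (all branches end at layer $L$). For every $v \in \mathcal{V}$ let a null-hypothesis $\mathcal{H}_0(v)$ about the probability measure underlying the observations be given, together with a test of $\mathcal{H}_0(v)$ whose probability of rejecting $\mathcal{H}_0(v)$ is at most $\alpha(v) \in [0,1]$ under every probability measure for which $\mathcal{H}_0(v)$ is true. No assumption is made on the joint distribution of the tests. Put $\alpha = \alpha(v_0)$. Suppose that for every vertex $v \in \mathcal{V}$ above the $L$-th layer $$\sum_{v' \in d(v)} \alpha(v') \le \alpha(v),$$ where $d(v)$ is the set of immediate descendants of $v$. Then, whatever the probability measure $P$ underlying the observations, the familywise error $\pi_1$ of the CaD procedure (the $P$-probability that at least one of the hypotheses rejected by the CaD procedure is true) satisfies $$\pi_1 \le \alpha .$$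
   Context: Tree: the root $v_0$ forms layer $0$; the immediate descendants $d(v)\subset\mathcal{V}$ of a vertex $v$ in layer $\ell$ lie in layer $\ell+1$; the number of descendants may differ across vertices. The tree has layers $0,1,\dots,L$, and completeness means that every vertex in a layer $\ell<L$ has at least one descendant, while vertices in layer $L$ have none. For a vertex $v$, let $U(v)$ denote the set of all vertices on the unique path from $v$ up to $v_0$, excluding $v$ itself. Hypotheses and tests: the observations are distributed according to a probability measure $P$ from some given class of probability measures on the observation space. Each null-hypothesis $\mathcal{H}_0(v)$ is a statement about $P$ (equivalently, a subset of the class), so given $P$ it is either true or false, independently of the experimental outcome. The test at $v$ is given by a rejection event $R_v$ (a measurable subset of the observation space), and the level condition is $P(R_v)\le\alpha(v)$ for every $P$ for which $\mathcal{H}_0(v)$ is true. CaD procedure: starting at the root $v_0$, keep testing downward along each branch of the tree as long as the respective null-hypothesis is rejected; stop testing along a branch upon the first acceptance of a null-hypothesis, and reject all null-hypotheses that have been rejected thus far. Equivalently, the procedure rejects $\mathcal{H}_0(v)$ if and only if the events $R_v$ and $R_u$, $u \in U(v)$, all occur. Familywise error: $\pi_1$ is the $P$-probability that there is at least one $v\in\mathcal{V}$ such that $\mathcal{H}_0(v)$ is true (under $P$) and $\mathcal{H}_0(v)$ is rejected by the CaD procedure. *)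

theory Defs
  imports "HOL-Probability.Probability" "Graph_Theory.Arc_Walk"
begin

text \<open>
  Arcs point away from the root. Uniqueness is required among all directed walks from the
  root: uniqueness of vertex-simple paths alone would still admit arcs that lead back to an
  ancestor. The predicate \<open>tree\<close> of the graph library is not suitable here: it only excludes
  directed cycles, hence admits, for instance, two parallel branches that meet again.
\<close>

locale rooted_tree = fin_digraph G for G :: "('v, 'e) pre_digraph" (structure) +
  fixes r :: 'v
  assumes root_in_verts: "r \<in> verts G"
    and ex1_awalk_from_root: "\<And>v. v \<in> verts G \<Longrightarrow> \<exists>!p. awalk r p v"

definition path_from_root :: "('v, 'e) pre_digraph \<Rightarrow> 'v \<Rightarrow> 'v \<Rightarrow> 'e list" where
  "path_from_root G r v = (THE p. pre_digraph.awalk G r p v)"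

definition layer :: "('v, 'e) pre_digraph \<Rightarrow> 'v \<Rightarrow> 'v \<Rightarrow> nat" where
  "layer G r v = length (path_from_root G r v)"

definition descendants :: "('v, 'e) pre_digraph \<Rightarrow> 'v \<Rightarrow> 'v set" where
  "descendants G v = {w. v \<rightarrow>\<^bsub>G\<^esub> w}"

definition ancestors :: "('v, 'e) pre_digraph \<Rightarrow> 'v \<Rightarrow> 'v \<Rightarrow> 'v set" where
  "ancestors G r v = set (pre_digraph.awalk_verts G r (path_from_root G r v)) - {v}"

definition complete_of_depth :: "('v, 'e) pre_digraph \<Rightarrow> 'v \<Rightarrow> nat \<Rightarrow> bool" where
  "complete_of_depth G r L \<longleftrightarrow>
     (\<forall>v\<in>verts G. layer G r v \<le> L
        \<and> (layer G r v < L \<longrightarrow> descendants G v \<noteq> {})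
        \<and> (layer G r v = L \<longrightarrow> descendants G v = {}))"

text \<open>
  \<open>cad_tested G r R x v\<close>: on observing \<open>x\<close>, the top-down procedure gets as far as testing
  the hypothesis at \<open>v\<close>; here \<open>R v\<close> is the event that the test at \<open>v\<close> rejects.
\<close>

inductive cad_tested ::
    "('v, 'e) pre_digraph \<Rightarrow> 'v \<Rightarrow> ('v \<Rightarrow> 'x set) \<Rightarrow> 'x \<Rightarrow> 'v \<Rightarrow> bool"
  for G r R x where
  root: "cad_tested G r R x r"
| step: "\<lbrakk>cad_tested G r R x u; x \<in> R u; w \<in> descendants G u\<rbrakk> \<Longrightarrow> cad_tested G r R x w"

definition cad_rejects ::
    "('v, 'e) pre_digraph \<Rightarrow> 'v \<Rightarrow> ('v \<Rightarrow> 'x set) \<Rightarrow> 'x \<Rightarrow> 'v \<Rightarrow> bool" where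
  "cad_rejects G r R x v \<longleftrightarrow> cad_tested G r R x v \<and> x \<in> R v"

text \<open>
  A hypothesis is identified with the set of probability measures for which it is true, so
  \<open>P \<in> H0 v\<close> says that the null hypothesis at \<open>v\<close> holds under \<open>P\<close>.
\<close>

definition familywise_error_event ::
    "('v, 'e) pre_digraph \<Rightarrow> 'v \<Rightarrow> ('v \<Rightarrow> 'x measure set) \<Rightarrow> ('v \<Rightarrow> 'x set) \<Rightarrow> 'x measure \<Rightarrow> 'x set"
  where
  "familywise_error_event G r H0 R P =
     {x \<in> space P. \<exists>v\<in>verts G. P \<in> H0 v \<and> cad_rejects G r R x v}"

definition familywise_error ::
    "('v, 'e) pre_digraph \<Rightarrow> 'v \<Rightarrow> ('v \<Rightarrow> 'x measure set) \<Rightarrow> ('v \<Rightarrow> 'x set) \<Rightarrow> 'x measure \<Rightarrow> real"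
  where
  "familywise_error G r H0 R P = measure P (familywise_error_event G r H0 R P)"

context rooted_tree
begin

lemma path_from_root_eq: "awalk r p v \<Longrightarrow> path_from_root G r v = p"
  using ex1_awalk_from_root[of v] unfolding path_from_root_def
  by (metis awalk_last_in_verts the_equality)

lemma ancestors_eq_butlast:
  assumes "awalk r p v"
  shows "ancestors G r v = set (butlast (awalk_verts r p))"
proof -
  have "v \<in> verts G" using assms by blast
  moreover have "apath r (awalk_to_apath p) v" using assms by (rule apath_awalk_to_apath)
  ultimately have "apath r p v"
    using ex1_awalk_from_root assms by (metis apath_def)
  then have d: "distinct (awalk_verts r p)" by (simp add: apath_def)
  have l: "last (awalk_verts r p) = v" using assms by auto
  have "awalk_verts r p = butlast (awalk_verts r p) @ [v]"
    using l by (metis append_butlast_last_id awalk_verts_non_Nil)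
  with d have "set (awalk_verts r p) - {v} = set (butlast (awalk_verts r p))"
    by (metis Diff_insert_absorb distinct_append distinct.simps(2) rotate1.simps(2)
        set_rotate1 list.simps(15) distinct1_rotate)
  then show ?thesis unfolding ancestors_def path_from_root_eq[OF assms] .
qed

lemma cad_tested_iff:
  assumes "awalk r p v"
  shows "cad_tested G r R x v \<longleftrightarrow> (\<forall>u\<in>ancestors G r v. x \<in> R u)"
  using assms
proof (induction p arbitrary: v rule: rev_induct)
  case Nil
  then have "v = r" by (simp add: awalk_Nil_iff)
  then show ?case using ancestors_eq_butlast[OF Nil] by (simp add: cad_tested.root)
next
  case (snoc e p)
  let ?u = "tail G e"
  have e: "e \<in> arcs G" "head G e = v" and p: "awalk r p ?u" and lu: "awlast r p = ?u"
    using snoc.prems by (auto simp: awalk_Cons_iff awalk_Nil_iff)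
  have uv: "v \<in> descendants G ?u"
    using e by (auto simp: descendants_def arcs_ends_conv)
  have verts_p: "awalk_verts r p = butlast (awalk_verts r p) @ [?u]"
    using lu by (metis append_butlast_last_id awalk_verts_non_Nil)
  have "butlast (awalk_verts r (p @ [e])) = awalk_verts r p"
    using awalk_verts_append[OF snoc.prems] by simp
  then have "ancestors G r v = set (awalk_verts r p)"
    using ancestors_eq_butlast[OF snoc.prems] by simp
  also have "\<dots> = insert ?u (ancestors G r ?u)"
    using ancestors_eq_butlast[OF p] verts_p
    by (metis list.simps(15) rotate1.simps(2) set_rotate1 set_append Un_insert_right
        sup_bot_right list.set(1))
  finally have anc: "ancestors G r v = insert ?u (ancestors G r ?u)" .
  have "cad_tested G r R x v \<longleftrightarrow> cad_tested G r R x ?u \<and> x \<in> R ?u"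
  proof
    assume "cad_tested G r R x v"
    then show "cad_tested G r R x ?u \<and> x \<in> R ?u"
    proof cases
      case root
      then have "awalk r [] v" using root_in_verts by (simp add: awalk_Nil_iff)
      then have False
        using snoc.prems path_from_root_eq by (metis Nil_is_append_conv not_Cons_self2)
      then show ?thesis ..
    next
      case (step u)
      then obtain e' where e': "e' \<in> arcs G" "tail G e' = u" "head G e' = v"
        by (auto simp: descendants_def)
      obtain q where q: "awalk r q u"
        using ex1_awalk_from_root[of u] e' by (metis tail_in_verts)
      have "awalk u [e'] v" using e' by (auto simp: awalk_Cons_iff awalk_Nil_iff)
      with q have "awalk r (q @ [e']) v" by (rule awalk_appendI)
      then have "e' = e"
        using snoc.prems path_from_root_eq by (metis last_snoc)
      then show ?thesis using step e' by simp
    qed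
  qed (use uv cad_tested.step in fast)
  then show ?case using snoc.IH[OF p] anc by auto
qed

lemma cad_rejects_iff:
  assumes "v \<in> verts G"
  shows "cad_rejects G r R x v \<longleftrightarrow> x \<in> R v \<and> (\<forall>u\<in>ancestors G r v. x \<in> R u)"
  using ex1_awalk_from_root[OF assms] cad_tested_iff unfolding cad_rejects_def by metis

text \<open>
  Since \<open>measure\<close> is \<open>0\<close> on non-measurable sets, the error probability is only meaningful
  because the error event is measurable.
\<close>

lemma familywise_error_event_in_sets:
  assumes "\<And>v. v \<in> verts G \<Longrightarrow> R v \<in> sets P"
  shows "familywise_error_event G r H0 R P \<in> sets P"
proof -
  have anc: "ancestors G r v \<subseteq> verts G" if v: "v \<in> verts G" for v
  proof -
    obtain p where p: "awalk r p v" using ex1_awalk_from_root[OF v] by blast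
    then have "set (awalk_verts r p) \<subseteq> verts G" by blast
    then show ?thesis unfolding ancestors_def path_from_root_eq[OF p] by blast
  qed
  have rej: "{x \<in> space P. cad_rejects G r R x v} \<in> sets P" if v: "v \<in> verts G" for v
  proof -
    have fin: "finite (insert v (ancestors G r v))"
      using anc[OF v] finite_subset finite_verts by blast
    have "{x \<in> space P. cad_rejects G r R x v} = (\<Inter>u\<in>insert v (ancestors G r v). R u)"
      using sets.sets_into_space[OF assms[OF v]] by (auto simp: cad_rejects_iff[OF v])
    also have "\<dots> \<in> sets P"
      using fin anc[OF v] v assms by (intro sets.finite_INT) auto
    finally show ?thesis .
  qed
  have "familywise_error_event G r H0 R P =
      (\<Union>v\<in>{v \<in> verts G. P \<in> H0 v}. {x \<in> space P. cad_rejects G r R x v})"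
    unfolding familywise_error_event_def by blast
  also have "\<dots> \<in> sets P" using rej by (intro sets.finite_UN) auto
  finally show ?thesis .
qed

end

end

(* The true hypotheses that the procedure started at v rejects lie below the topmost true
   hypotheses on the branches from v. If the hypothesis at v is true, the error event is
   contained in R v; otherwise it is contained in the union of the error events of the
   procedures started at the descendants of v. Induction from the leaves up and the union
   bound give the level \<alpha> v. *)

theory Submission
  imports Defs
begin

text \<open>The rules of \<open>cad_tested\<close> extend a run at its lower end, whereas the
  recursion over the tree has to split off the first step. The starting vertex is a parameter of
  \<open>cad_tested\<close>, so the rest of the run is again a run in the same graph
  \<open>G\<close>, and no subtree has to be formed.\<close>

lemma cad_tested_from_descendant:
  assumes "cad_tested G v R x w"
  shows "w = v \<or> x \<in> R v \<and> (\<exists>d\<in>descendants G v. cad_tested G d R x w)"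
  using assms
proof induction
  case root
  then show ?case by simp
next
  case (step u w)
  show ?case
  proof (cases "u = v")
    case True
    \<comment> \<open>The new vertex \<open>w\<close> is itself the descendant, and the run started
      there tests it at once.\<close>
    then show ?thesis using step.hyps cad_tested.root by metis
  next
    case False
    then show ?thesis using step cad_tested.step by metis
  qed
qed

lemma familywise_error_event_subset_root:
  "familywise_error_event G v H0 R P \<subseteq> R v"
  using cad_tested_from_descendant unfolding familywise_error_event_def cad_rejects_def by fast

lemma familywise_error_event_subset_descendants:
  assumes "P \<notin> H0 v"
  shows "familywise_error_event G v H0 R P
    \<subseteq> (\<Union>d\<in>descendants G v. familywise_error_event G d H0 R P)"
proof
  fix x assume "x \<in> familywise_error_event G v H0 R P"
  then obtain w where w: "x \<in> space P" "w \<in> verts G" "P \<in> H0 w" "x \<in> R w" "cad_tested G v R x w"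
    unfolding familywise_error_event_def cad_rejects_def by blast
  then have "w \<noteq> v" using assms by blast
  then show "x \<in> (\<Union>d\<in>descendants G v. familywise_error_event G d H0 R P)"
    using w cad_tested_from_descendant[OF w(5)]
    unfolding familywise_error_event_def cad_rejects_def by blast
qed

context rooted_tree
begin

lemma descendants_subset_verts: "descendants G v \<subseteq> verts G"
  unfolding descendants_def by (auto dest: adj_in_verts)

text \<open>Appending the arc to the walk to \<open>v\<close> gives the unique walk to
  \<open>w\<close>. This makes the induction measure \<open>L - layer G r v\<close> drop along
  arcs.\<close>

lemma layer_descendant:
  assumes "v \<in> verts G" and "w \<in> descendants G v"
  shows "layer G r w = Suc (layer G r v)"
proof -
  obtain p where p: "awalk r p v" using ex1_awalk_from_root[OF assms(1)] by blast
  obtain e where e: "e \<in> arcs G" "tail G e = v" "head G e = w"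
    using assms(2) by (auto simp: descendants_def)
  then have "awalk v [e] w" by (auto simp: awalk_Cons_iff awalk_Nil_iff)
  with p have "awalk r (p @ [e]) w" by (rule awalk_appendI)
  then have "path_from_root G r w = p @ [e]" by (rule path_from_root_eq)
  with path_from_root_eq[OF p] show ?thesis by (simp add: layer_def)
qed

(* The error event is covered by a measurable set because only the event of the procedure
   started at the root of the tree is known to be measurable. *)
lemma familywise_error_event_cover:
  assumes "finite_measure P" and "complete_of_depth G r L"
    and "\<And>u. u \<in> verts G \<Longrightarrow> R u \<in> sets P"
    and "\<And>u. u \<in> verts G \<Longrightarrow> 0 \<le> \<alpha> u"
    and "\<And>u. u \<in> verts G \<Longrightarrow> P \<in> H0 u \<Longrightarrow> measure P (R u) \<le> \<alpha> u"
    and "\<And>u. u \<in> verts G \<Longrightarrow> layer G r u < L \<Longrightarrow> (\<Sum>w\<in>descendants G u. \<alpha> w) \<le> \<alpha> u"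
    and "v \<in> verts G"
  shows "\<exists>A\<in>sets P. familywise_error_event G v H0 R P \<subseteq> A \<and> measure P A \<le> \<alpha> v"
  using assms(7)
proof (induction "L - layer G r v" arbitrary: v rule: less_induct)
  case less
  interpret P: finite_measure P by fact
  note v = \<open>v \<in> verts G\<close>
  show ?case
  proof (cases "P \<in> H0 v")
    case True
    then show ?thesis
      using assms(3,5)[OF v] familywise_error_event_subset_root[of G v H0 R P] by blast
  next
    case False
    let ?D = "descendants G v"
    have fin: "finite ?D" using descendants_subset_verts finite_subset finite_verts by blast
    \<comment> \<open>By completeness, layer \<open>L\<close> has no descendants. The strict bound
      makes the truncated difference \<open>L - layer G r v\<close> really decrease, and it is the
      condition under which the levels of the descendants sum to at most
      \<open>\<alpha> v\<close>.\<close>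
    have below: "layer G r v < L" if "?D \<noteq> {}"
      using assms(2) v that unfolding complete_of_depth_def by (meson le_neq_implies_less)
    have "\<forall>d\<in>?D. \<exists>A. A \<in> sets P \<and> familywise_error_event G d H0 R P \<subseteq> A \<and> measure P A \<le> \<alpha> d"
    proof
      fix d assume d: "d \<in> ?D"
      then have "layer G r v < L" using below by blast
      then have "L - layer G r d < L - layer G r v" using layer_descendant[OF v d] by simp
      then show "\<exists>A. A \<in> sets P \<and> familywise_error_event G d H0 R P \<subseteq> A \<and> measure P A \<le> \<alpha> d"
        using less.hyps[of d] d descendants_subset_verts[of v] by (simp add: Bex_def subset_iff)
    qed
    then obtain A where A: "\<And>d. d \<in> ?D \<Longrightarrow> A d \<in> sets P"
        "\<And>d. d \<in> ?D \<Longrightarrow> familywise_error_event G d H0 R P \<subseteq> A d"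
        "\<And>d. d \<in> ?D \<Longrightarrow> measure P (A d) \<le> \<alpha> d"
      by metis
    have "measure P (\<Union>d\<in>?D. A d) \<le> (\<Sum>d\<in>?D. measure P (A d))"
      using fin A(1) by (intro P.finite_measure_subadditive_finite) auto
    also have "\<dots> \<le> (\<Sum>d\<in>?D. \<alpha> d)" using A(3) by (rule sum_mono)
    also have "\<dots> \<le> \<alpha> v"
      \<comment> \<open>At a leaf the sum is empty, and the bound is
        \<open>0 \<le> \<alpha> v\<close>.\<close>
      using below assms(4,6)[OF v] by (cases "?D = {}") auto
    finally have "measure P (\<Union>d\<in>?D. A d) \<le> \<alpha> v" .
    moreover have "(\<Union>d\<in>?D. A d) \<in> sets P" using fin A(1) by (rule sets.finite_UN)
    moreover have "familywise_error_event G v H0 R P \<subseteq> (\<Union>d\<in>?D. A d)"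
      using familywise_error_event_subset_descendants[of P H0 v G R] False A(2) by blast
    ultimately show ?thesis by blast
  qed
qed

end

theorem proposition2p1:
  fixes G :: "('v, 'e) pre_digraph" and v0 :: 'v and L :: nat
    and M :: "'x measure"
    and \<P> :: "'x measure set"
    and H0 :: "'v \<Rightarrow> 'x measure set"
    and R :: "'v \<Rightarrow> 'x set"
    and \<alpha> :: "'v \<Rightarrow> real"
    and P :: "'x measure"
  assumes "rooted_tree G v0"
    and "L \<ge> 1"
    and "complete_of_depth G v0 L"
    and "\<And>Q. Q \<in> \<P> \<Longrightarrow> prob_space Q \<and> sets Q = sets M"
    and "\<And>v. v \<in> verts G \<Longrightarrow> H0 v \<subseteq> \<P>"
    and "\<And>v. v \<in> verts G \<Longrightarrow> R v \<in> sets M"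
    and "\<And>v. v \<in> verts G \<Longrightarrow> \<alpha> v \<in> {0..1}"
    and "\<And>v Q. v \<in> verts G \<Longrightarrow> Q \<in> H0 v \<Longrightarrow> measure Q (R v) \<le> \<alpha> v"
    and "\<And>v. v \<in> verts G \<Longrightarrow> layer G v0 v < L \<Longrightarrow> (\<Sum>v'\<in>descendants G v. \<alpha> v') \<le> \<alpha> v"
    and "P \<in> \<P>"
  shows "familywise_error G v0 H0 R P \<le> \<alpha> v0"
proof -
  interpret rooted_tree G v0 by fact
  have "prob_space P" and sets_P: "sets P = sets M" using assms(4,10) by auto
  interpret P: prob_space P by fact
  obtain A where "A \<in> sets P" "familywise_error_event G v0 H0 R P \<subseteq> A" "measure P A \<le> \<alpha> v0"
    using familywise_error_event_cover[OF P.finite_measure_axioms assms(3), of R \<alpha> H0 v0]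
      assms(6-9) sets_P root_in_verts by fastforce
  \<comment> \<open>Monotonicity of \<open>measure\<close> asks only that the larger set
    \<open>A\<close> be measurable.\<close>
  then show ?thesis
    unfolding familywise_error_def using P.finite_measure_mono order_trans by blast
qed

end
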